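(* Let $R$ be a finite commutative ring with identity and $P$ a proper prime ideal of $R$ with $|P|\geq 2$; let $I=I(\Gamma_P(R))\subseteq S=k[x_1,\ldots,x_a,y_1,\ldots,y_b]$ be the edge ideal of the prime ideal graph, where $a=|P|-1$ and $b=|P|(|R/P|-1)$. For every integer $n\geq 1$, $$G(I^n)=\left\{x^\alpha y^\beta:\ \alpha\in\mathbb{N}^a,\ \beta\in\mathbb{N}^b,\ |\alpha|+|\beta|=2n,\; |\beta|\leq n,\; 0\leq \alpha_i\leq n\text{ for all }i=1,\ldots,a\right\}.$$
   Context: The prime ideal graph $\Gamma_P(R)$ is the simple graph with vertex set $R\setminus\{0\}$ in which two distinct vertices $x,y$ are adjacent if and only if $xy\in P$. Put $a=|P|-1$ and $b=|P|(|R/P|-1)=|R\setminus P|$. Write $P\setminus\{0\}=\{u_1,\ldots,u_a\}$, $R\setminus P=\{v_1,\ldots,v_b\}$; attach the variable $x_i$ to $u_i$ and $y_\ell$ to $v_\ell$. Let $k$ be a field and $S=k[x_1,\ldots,x_a,y_1,\ldots,y_b]$. The edge ideal $I=I(\Gamma_P(R))$ is the ideal of $S$ generated by the products of the two variables attached to the endpoints of each edge; explicitly $I=(x_ix_j,\;x_iy_\ell \mid 1\leq i<j\leq a,\;1\leq i\leq a,\;1\leq \ell\leq b)$. $\mathbb{N}$ includes $0$; $x^\alpha=x_1^{\alpha_1}\cdots x_a^{\alpha_a}$, $y^\beta=y_1^{\beta_1}\cdots y_b^{\beta_b}$, $|\alpha|=\sum_i\alpha_i$, $|\beta|=\sum_\ell\beta_\ell$.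 For a monomial ideal $L$, $G(L)$ denotes its set of minimal monomial generators. *)

theory Defs
  imports "HOL-Algebra.QuotRing" "HOL-Algebra.Ideal_Product" "HOL-Library.Poly_Mapping"
begin

section \<open>Polynomial rings with a prescribed set of variables\<close>

text \<open>
  A polynomial in variables of type \<open>'v\<close> is a finitely supported function on exponent vectors,
  which are themselves finitely supported functions \<open>'v \<Rightarrow>\<^sub>0 nat\<close>. The carrier \<open>k[V]\<close> is cut down
  to the polynomials whose variables all lie in \<open>V\<close>, so that \<open>V\<close> need not be a whole type.
\<close>

type_synonym ('v, 'k) mpol = "('v \<Rightarrow>\<^sub>0 nat) \<Rightarrow>\<^sub>0 'k"

definition mpol_carrier :: "'v set \<Rightarrow> ('v, 'k::zero) mpol set" where
  "mpol_carrier V = {p. \<forall>m\<in>Poly_Mapping.keys p. Poly_Mapping.keys m \<subseteq> V}"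

definition mpol_ring :: "'v set \<Rightarrow> ('v, 'k::comm_ring_1) mpol ring" where
  "mpol_ring V = \<lparr>carrier = mpol_carrier V, mult = (*), one = 1, zero = 0, add = (+)\<rparr>"

definition monom :: "('v \<Rightarrow>\<^sub>0 nat) \<Rightarrow> ('v, 'k::zero_neq_one) mpol" where
  "monom m = Poly_Mapping.single m 1"

definition Var :: "'v \<Rightarrow> ('v, 'k::zero_neq_one) mpol" where
  "Var v = monom (Poly_Mapping.single v 1)"

definition monomials :: "'v set \<Rightarrow> ('v, 'k::zero_neq_one) mpol set" where
  "monomials V = {monom m | m. Poly_Mapping.keys m \<subseteq> V}"


section \<open>Minimal monomial generators\<close>

definition is_min_mon_gens :: "'v set \<Rightarrow> ('v, 'k::comm_ring_1) mpol set \<Rightarrow> ('v, 'k) mpol set \<Rightarrow> bool" where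
  "is_min_mon_gens V L G \<longleftrightarrow>
     G \<subseteq> monomials V \<and> genideal (mpol_ring V) G = L \<and>
     (\<forall>H. H \<subset> G \<longrightarrow> genideal (mpol_ring V) H \<noteq> L)"

text \<open>
  \<open>G(L)\<close>. The description is proper for every monomial ideal \<open>L\<close>; see \<open>ex1_min_mon_gens\<close> below.
\<close>

definition min_mon_gens :: "'v set \<Rightarrow> ('v, 'k::comm_ring_1) mpol set \<Rightarrow> ('v, 'k) mpol set" where
  "min_mon_gens V L = (THE G. is_min_mon_gens V L G)"


section \<open>Edge ideals and the prime ideal graph\<close>

text \<open>A simple graph is a pair of a vertex set and a set of two-element sets of vertices.\<close>

type_synonym 'v sgraph = "'v set \<times> 'v set set"

definition edge_ideal :: "'v sgraph \<Rightarrow> ('v, 'k::comm_ring_1) mpol set" where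
  "edge_ideal \<Gamma> = genideal (mpol_ring (fst \<Gamma>)) {Var x * Var y | x y. {x, y} \<in> snd \<Gamma>}"

definition prime_ideal_graph :: "('r, 'm) ring_scheme \<Rightarrow> 'r set \<Rightarrow> 'r sgraph" where
  "prime_ideal_graph R P =
     (carrier R - {\<zero>\<^bsub>R\<^esub>},
      {{x, y} | x y. x \<in> carrier R - {\<zero>\<^bsub>R\<^esub>} \<and> y \<in> carrier R - {\<zero>\<^bsub>R\<^esub>} \<and> x \<noteq> y \<and> x \<otimes>\<^bsub>R\<^esub> y \<in> P})"


section \<open>Well-definedness\<close>

lemma mpol_ring_sel [simp]:
  "carrier (mpol_ring V) = mpol_carrier V"
  "mult (mpol_ring V) = (*)" "one (mpol_ring V) = 1"
  "zero (mpol_ring V) = 0" "add (mpol_ring V) = (+)"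
  by (simp_all add: mpol_ring_def)

lemma mpol_carrier_plus: "p \<in> mpol_carrier V \<Longrightarrow> q \<in> mpol_carrier V \<Longrightarrow> p + q \<in> mpol_carrier V"
  using keys_add[of p q] unfolding mpol_carrier_def by blast

lemma mpol_carrier_uminus:
  "(p :: ('v, 'k::comm_ring_1) mpol) \<in> mpol_carrier V \<Longrightarrow> - p \<in> mpol_carrier V"
  by (auto simp: mpol_carrier_def in_keys_iff)

lemma mpol_carrier_times:
  assumes "p \<in> mpol_carrier V" "q \<in> mpol_carrier V"
  shows "(p :: ('v, 'k::comm_ring_1) mpol) * q \<in> mpol_carrier V"
proof -
  have "Poly_Mapping.keys m \<subseteq> V" if *: "m \<in> Poly_Mapping.keys (p * q)" for m
  proof -
    obtain c d where m: "m = c + d" "c \<in> Poly_Mapping.keys p" "d \<in> Poly_Mapping.keys q"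
      using keys_mult[of p q] * by blast
    show ?thesis
      using keys_add[of c d] m assms unfolding mpol_carrier_def by blast
  qed
  then show ?thesis by (simp add: mpol_carrier_def)
qed

lemma cring_mpol_ring: "cring (mpol_ring V :: ('v, 'k::comm_ring_1) mpol ring)"
proof (rule cringI)
  show "abelian_group (mpol_ring V :: ('v, 'k) mpol ring)"
  proof (rule abelian_groupI)
    fix p :: "('v, 'k) mpol" assume "p \<in> carrier (mpol_ring V)"
    then show "\<exists>q\<in>carrier (mpol_ring V). q \<oplus>\<^bsub>mpol_ring V\<^esub> p = \<zero>\<^bsub>mpol_ring V\<^esub>"
      using mpol_carrier_uminus by (intro bexI[of _ "- p"]) auto
  qed (auto simp: mpol_carrier_plus add.assoc add.commute, auto simp: mpol_carrier_def)
  show "comm_monoid (mpol_ring V :: ('v, 'k) mpol ring)"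
    by (rule comm_monoidI)
       (auto simp: mpol_carrier_times mult.assoc mult.commute, auto simp: mpol_carrier_def)
qed (auto simp: distrib_right)

lemma monom_in_carrier [simp]:
  "(monom m :: ('v, 'k::comm_ring_1) mpol) \<in> mpol_carrier V \<longleftrightarrow> Poly_Mapping.keys m \<subseteq> V"
  by (auto simp: mpol_carrier_def monom_def)

lemma monomials_subset: "(monomials V :: ('v, 'k::comm_ring_1) mpol set) \<subseteq> mpol_carrier V"
  by (auto simp: monomials_def)

lemma monom_inj [simp]:
  "(monom m :: ('v, 'k::comm_ring_1) mpol) = monom m' \<longleftrightarrow> m = m'"
proof
  assume "(monom m :: ('v, 'k) mpol) = monom m'"
  then have "Poly_Mapping.keys (monom m :: ('v, 'k) mpol) = Poly_Mapping.keys (monom m' :: ('v, 'k) mpol)"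
    by simp
  then show "m = m'" by (simp add: monom_def)
qed simp

lemma monom_mult: "(monom c :: ('v, 'k::comm_ring_1) mpol) * monom d = monom (c + d)"
  by (simp add: monom_def mult_single)

text \<open>A monomial lies in an ideal generated by monomials iff one of the generators divides it.\<close>

lemma keys_genideal:
  fixes G :: "('v, 'k::comm_ring_1) mpol set"
  assumes G: "G \<subseteq> monomials V" and p: "p \<in> genideal (mpol_ring V) G"
    and m: "m \<in> Poly_Mapping.keys p"
  shows "\<exists>g d. monom g \<in> G \<and> m = g + d"
proof -
  interpret cring "mpol_ring V :: ('v, 'k) mpol ring" by (rule cring_mpol_ring)
  define D :: "('v, 'k) mpol set" where
    "D = {p \<in> mpol_carrier V. \<forall>m\<in>Poly_Mapping.keys p. \<exists>g d. monom g \<in> G \<and> m = g + d}"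
  have mult: "q * p \<in> D" if "p \<in> D" "q \<in> mpol_carrier V" for p q :: "('v, 'k) mpol"
  proof -
    have "\<exists>g d. monom g \<in> G \<and> m = g + d" if "m \<in> Poly_Mapping.keys (q * p)" for m
    proof -
      obtain c d where cd: "m = c + d" "d \<in> Poly_Mapping.keys p"
        using keys_mult[of q p] \<open>m \<in> _\<close> by blast
      then obtain g e where "monom g \<in> G" "d = g + e"
        using \<open>p \<in> D\<close> unfolding D_def by blast
      with cd show ?thesis by (intro exI[of _ g] exI[of _ "c + e"]) (simp add: ac_simps)
    qed
    then show ?thesis using that mpol_carrier_times unfolding D_def by blast
  qed
  have "ideal D (mpol_ring V)"
  proof (rule idealI[OF ring_axioms])
    show "subgroup D (add_monoid (mpol_ring V))"
    proof (rule group.subgroupI)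
      show "Group.group (add_monoid (mpol_ring V :: ('v, 'k) mpol ring))" by (rule add.is_group)
      show "D \<subseteq> carrier (add_monoid (mpol_ring V))" by (auto simp: D_def)
      have "0 \<in> D" by (auto simp: D_def mpol_carrier_def)
      then show "D \<noteq> {}" by blast
    next
      fix p assume p: "p \<in> D"
      then have pc: "p \<in> mpol_carrier V" by (simp add: D_def)
      have "- p \<in> D"
        using p mpol_carrier_uminus[OF pc] by (simp add: D_def)
      moreover have "inv\<^bsub>add_monoid (mpol_ring V)\<^esub> p = - p"
        using minus_equality[of "- p" p] pc mpol_carrier_uminus[OF pc] by (simp add: a_inv_def)
      ultimately show "inv\<^bsub>add_monoid (mpol_ring V)\<^esub> p \<in> D" by simp
    next
      fix p q assume "p \<in> D" "q \<in> D"
      then have "p + q \<in> D"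
        using keys_add[of p q] mpol_carrier_plus[of p V q] unfolding D_def by blast
      then show "p \<otimes>\<^bsub>add_monoid (mpol_ring V)\<^esub> q \<in> D" by simp
    qed
  qed (auto simp: mult, metis mult mult.commute)
  moreover have "G \<subseteq> D"
  proof
    fix x assume "x \<in> G"
    moreover from this obtain g where g: "x = monom g" "Poly_Mapping.keys g \<subseteq> V"
      using G by (auto simp: monomials_def)
    moreover have "Poly_Mapping.keys x = {g}" using g by (simp add: monom_def)
    moreover have "g = g + 0" by simp
    ultimately show "x \<in> D" unfolding D_def by auto
  qed
  ultimately have "genideal (mpol_ring V) G \<subseteq> D" by (rule genideal_minimal)
  then show ?thesis using p m unfolding D_def by blast
qed

lemma monom_in_genideal_iff:
  fixes G :: "('v, 'k::comm_ring_1) mpol set"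
  assumes G: "G \<subseteq> monomials V"
  shows "(monom m :: ('v, 'k) mpol) \<in> genideal (mpol_ring V) G \<longleftrightarrow>
         Poly_Mapping.keys m \<subseteq> V \<and> (\<exists>g d. (monom g :: ('v, 'k) mpol) \<in> G \<and> m = g + d)"
    (is "?L \<longleftrightarrow> ?R")
proof -
  interpret cring "mpol_ring V :: ('v, 'k) mpol ring" by (rule cring_mpol_ring)
  have Gc: "G \<subseteq> carrier (mpol_ring V)" using G monomials_subset by auto
  have I: "ideal (genideal (mpol_ring V) G) (mpol_ring V)" by (rule genideal_ideal[OF Gc])
  show ?thesis
  proof
    assume L: ?L
    then have "(monom m :: ('v, 'k) mpol) \<in> carrier (mpol_ring V)"
      using ideal.Icarr[OF I] by blast
    moreover have "\<exists>g d. (monom g :: ('v, 'k) mpol) \<in> G \<and> m = g + d"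
      by (rule keys_genideal[OF G L]) (simp add: monom_def)
    ultimately show ?R by simp
  next
    assume ?R
    then obtain g d where gd: "(monom g :: ('v, 'k) mpol) \<in> G" "m = g + d"
      and "Poly_Mapping.keys m \<subseteq> V" by blast
    moreover have "Poly_Mapping.keys d \<subseteq> Poly_Mapping.keys m"
      using gd by (auto simp: in_keys_iff lookup_add)
    ultimately have "(monom d :: ('v, 'k) mpol) \<in> carrier (mpol_ring V)" by simp
    from ideal.I_r_closed[OF I _ this, of "monom g"] show ?L
      using genideal_self[OF Gc] gd by (auto simp: monom_mult)
  qed
qed

theorem ex1_min_mon_gens:
  fixes L :: "('v, 'k::comm_ring_1) mpol set"
  assumes M: "M \<subseteq> monomials V" and L: "L = genideal (mpol_ring V) M"
  shows "\<exists>!G. is_min_mon_gens V L G"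
proof -
  interpret cring "mpol_ring V :: ('v, 'k) mpol ring" by (rule cring_mpol_ring)
  define Mn :: "('v, 'k) mpol set" where
    "Mn = {monom m | m. monom m \<in> L \<and>
             (\<forall>g d. (monom g :: ('v, 'k) mpol) \<in> L \<longrightarrow> m = g + d \<longrightarrow> d = 0)}"
  have sub: "Mn \<subseteq> G" if G: "G \<subseteq> monomials V" "genideal (mpol_ring V) G = L" for G
  proof
    fix x assume "x \<in> Mn"
    then obtain m where m: "x = monom m" "(monom m :: ('v, 'k) mpol) \<in> L"
      "\<And>g d. (monom g :: ('v, 'k) mpol) \<in> L \<Longrightarrow> m = g + d \<Longrightarrow> d = 0"
      unfolding Mn_def by blast
    then obtain g d where gd: "(monom g :: ('v, 'k) mpol) \<in> G" "m = g + d"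
      using monom_in_genideal_iff[OF G(1), of m] G(2) by blast
    have "G \<subseteq> L" using genideal_self[of G] G monomials_subset by auto
    then have "d = 0" using gd m(3) by blast
    then show "x \<in> G" using gd m(1) by simp
  qed
  have Mn: "Mn \<subseteq> monomials V"
    using sub[OF M] L M by blast
  have size: "(\<Sum>v\<in>Poly_Mapping.keys (g + d). Poly_Mapping.lookup (g + d) v) =
      (\<Sum>v\<in>Poly_Mapping.keys g. Poly_Mapping.lookup g v) +
      (\<Sum>v\<in>Poly_Mapping.keys d. Poly_Mapping.lookup d v)" for g d :: "'v \<Rightarrow>\<^sub>0 nat"
    using setsum_keys_plus_distrib[of "\<lambda>_ x. x" g d] by simp
  have div: "\<exists>g d. (monom g :: ('v, 'k) mpol) \<in> Mn \<and> m = g + d"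
    if "(monom m :: ('v, 'k) mpol) \<in> L" for m
    using that
  proof (induction "\<Sum>v\<in>Poly_Mapping.keys m. Poly_Mapping.lookup m v" arbitrary: m rule: less_induct)
    case less
    show ?case
    proof (cases "(monom m :: ('v, 'k) mpol) \<in> Mn")
      case True
      then show ?thesis by (intro exI[of _ m] exI[of _ 0]) simp
    next
      case False
      then obtain g d where gd: "(monom g :: ('v, 'k) mpol) \<in> L" "m = g + d" "d \<noteq> 0"
        using less.prems unfolding Mn_def by blast
      have "(\<Sum>v\<in>Poly_Mapping.keys d. Poly_Mapping.lookup d v) > 0"
        using gd(3) by (intro sum_pos) (auto simp: in_keys_iff)
      then have "\<exists>g' d'. (monom g' :: ('v, 'k) mpol) \<in> Mn \<and> g = g' + d'"
        using gd(1,2) size[of g d] by (intro less.hyps) auto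
      then obtain g' d' where "(monom g' :: ('v, 'k) mpol) \<in> Mn" "g = g' + d'" by blast
      with gd(2) show ?thesis
        by (intro exI[of _ g'] exI[of _ "d' + d"]) (simp add: ac_simps)
    qed
  qed
  have Mnc: "Mn \<subseteq> carrier (mpol_ring V)" and Mc: "M \<subseteq> carrier (mpol_ring V)"
    using Mn M monomials_subset by auto
  have gen: "genideal (mpol_ring V) Mn = L"
  proof
    have "Mn \<subseteq> L" unfolding Mn_def by blast
    then show "genideal (mpol_ring V) Mn \<subseteq> L"
      unfolding L by (rule genideal_minimal[OF genideal_ideal[OF Mc]])
    have "M \<subseteq> genideal (mpol_ring V) Mn"
    proof
      fix x assume x: "x \<in> M"
      then obtain m where m: "x = monom m" "Poly_Mapping.keys m \<subseteq> V"
        using M by (auto simp: monomials_def)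
      have "x \<in> L" using genideal_self[OF Mc] x L by auto
      then show "x \<in> genideal (mpol_ring V) Mn"
        using div m monom_in_genideal_iff[OF Mn, of m] by auto
    qed
    then show "L \<subseteq> genideal (mpol_ring V) Mn"
      unfolding L by (rule genideal_minimal[OF genideal_ideal[OF Mnc]])
  qed
  show ?thesis
  proof (rule ex1I)
    show "is_min_mon_gens V L Mn"
      unfolding is_min_mon_gens_def using Mn gen sub by blast
    show "G = Mn" if "is_min_mon_gens V L G" for G
      using that sub[of G] gen unfolding is_min_mon_gens_def by blast
  qed
qed

text \<open>The two expressions for the number of vertices outside \<open>P\<close> agree.\<close>

lemma card_outside_ideal:
  assumes P: "ideal P R" and fin: "finite (carrier R)"
  shows "card (carrier R - P) = card P * (card (carrier (R Quot P)) - 1)"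
proof -
  interpret ideal P R by (rule P)
  have sub: "P \<subseteq> carrier R" by (rule a_subset)
  have "card (a_rcosets\<^bsub>R\<^esub> P) * card P = card (carrier R)"
    using group.lagrange[OF add.is_group a_subgroup]
    by (simp add: A_RCOSETS_def Coset.order_def mult.commute)
  moreover have "card (carrier R - P) = card (carrier R) - card P"
    using sub fin by (simp add: card_Diff_subset finite_subset)
  ultimately show ?thesis
    by (simp add: FactRing_def diff_mult_distrib2 mult.commute)
qed

end

theory Submission
  imports Defs
begin

text \<open>
  Colour every vertex of \<open>\<Gamma>\<^sub>P(R)\<close> lying in \<open>P\<close> with itself and give all vertices outside \<open>P\<close> one
  further colour. Since \<open>P\<close> is prime, two vertices are adjacent iff their colours differ: the graph
  is complete multipartite, and the edge ideal only sees the colouring.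

  For any colouring \<open>c\<close> of a finite vertex set, \<open>I\<^sup>n\<close> is generated by the products of \<open>n\<close> edges.
  Such a product has degree \<open>2n\<close>, and no colour occurs in it more than \<open>n\<close> times, because an edge
  uses a colour at most once. Conversely (\<open>balanced_Suc_split\<close>) every monomial satisfying these two
  conditions is a product of \<open>n\<close> edges: split off an edge joining the two most frequent colours.
  A third colour cannot be so frequent that this spoils the condition for \<open>n - 1\<close>, since three
  colours occurring \<open>n\<close> times each would need degree \<open>3n > 2n\<close>. This identifies \<open>I\<^sup>n\<close> with
  the ideal generated by the balanced monomials (\<open>edge_ideal_power_multipartite\<close>).

  These generators all have the same degree, so none divides another and they are the minimal ones
  (\<open>min_mon_gens_equal_degree\<close>). For the colouring above, being balanced says \<open>\<alpha>\<^sub>i \<le> n\<close> for the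
  singleton colour classes and \<open>|\<beta>| \<le> n\<close> for the remaining one.
\<close>

section \<open>Products of generated ideals\<close>

lemma (in cring) ideal_colon:
  assumes K: "ideal K R" and x: "x \<in> carrier R"
  shows "ideal {y \<in> carrier R. x \<otimes> y \<in> K} R"
proof (rule idealI[OF ring_axioms])
  interpret K: ideal K R by (rule K)
  show "subgroup {y \<in> carrier R. x \<otimes> y \<in> K} (add_monoid R)"
  proof (rule add.subgroupI)
    show "{y \<in> carrier R. x \<otimes> y \<in> K} \<noteq> {}" using x by auto
  next
    fix y assume "y \<in> {y \<in> carrier R. x \<otimes> y \<in> K}"
    then show "\<ominus> y \<in> {y \<in> carrier R. x \<otimes> y \<in> K}"
      using x by (auto simp: r_minus)
  next
    fix y z assume "y \<in> {y \<in> carrier R. x \<otimes> y \<in> K}" "z \<in> {y \<in> carrier R. x \<otimes> y \<in> K}"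
    then show "y \<oplus> z \<in> {y \<in> carrier R. x \<otimes> y \<in> K}"
      using x by (auto simp: r_distr)
  qed auto
next
  interpret K: ideal K R by (rule K)
  fix y r assume y: "y \<in> {y \<in> carrier R. x \<otimes> y \<in> K}" and r: "r \<in> carrier R"
  then show "r \<otimes> y \<in> {y \<in> carrier R. x \<otimes> y \<in> K}"
    using x K.I_l_closed[of "x \<otimes> y" r] by (auto simp: m_lcomm)
  with y r show "y \<otimes> r \<in> {y \<in> carrier R. x \<otimes> y \<in> K}"
    by (auto simp: m_comm)
qed

text \<open>
  The only real inclusion is that products of arbitrary elements of the two ideals are generated by
  products of generators. By \<open>ideal_colon\<close>, the elements that a fixed \<open>x\<close> multiplies into a
  given ideal form an ideal, so it suffices to test generators, in one argument and then in the
  other.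
\<close>

lemma (in cring) ideal_prod_genideal:
  assumes A: "A \<subseteq> carrier R" and B: "B \<subseteq> carrier R"
  shows "ideal_prod R (Idl A) (Idl B) = Idl {x \<otimes> y | x y. x \<in> A \<and> y \<in> B}"
    (is "?L = Idl ?AB")
proof
  have AB: "?AB \<subseteq> carrier R" using A B by auto
  have IA: "ideal (Idl A) R" and IB: "ideal (Idl B) R" and K: "ideal (Idl ?AB) R"
    using A B AB by (auto intro: genideal_ideal)
  interpret K: ideal "Idl ?AB" R by (rule K)
  have 1: "x \<otimes> y \<in> Idl ?AB" if "x \<in> A" "y \<in> Idl B" for x y
  proof -
    have "Idl B \<subseteq> {y \<in> carrier R. x \<otimes> y \<in> Idl ?AB}"
      using genideal_self[OF AB] that(1) A B
      by (intro genideal_minimal ideal_colon K) auto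
    then show ?thesis using that(2) by blast
  qed
  have 2: "x \<otimes> y \<in> Idl ?AB" if "x \<in> Idl A" "y \<in> Idl B" for x y
  proof -
    have y: "y \<in> carrier R" using that(2) ideal.Icarr[OF IB] by blast
    have "Idl A \<subseteq> {x \<in> carrier R. y \<otimes> x \<in> Idl ?AB}"
      using 1[OF _ that(2)] A y
      by (intro genideal_minimal ideal_colon K) (auto simp: m_comm subset_iff)
    then show ?thesis using that(1) y by (auto simp: m_comm)
  qed
  show "?L \<subseteq> Idl ?AB"
  proof
    fix s assume "s \<in> ?L"
    then show "s \<in> Idl ?AB" by (induction rule: ideal_prod.induct) (auto simp: 2)
  qed
  show "Idl ?AB \<subseteq> ?L"
    using genideal_self[OF A] genideal_self[OF B]
    by (intro genideal_minimal ideal_prod_is_ideal IA IB) (auto intro!: ideal_prod.prod)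
qed

section \<open>Weights of exponent vectors\<close>

definition weight :: "'v set \<Rightarrow> ('v \<Rightarrow>\<^sub>0 nat) \<Rightarrow> nat" where
  "weight A m = (\<Sum>z\<in>A. Poly_Mapping.lookup m z)"

lemma weight_add: "weight A (m + m') = weight A m + weight A m'"
  by (simp add: weight_def lookup_add sum.distrib)

lemma weight_0 [simp]: "weight A 0 = 0"
  by (simp add: weight_def)

lemma weight_single:
  "finite A \<Longrightarrow> weight A (Poly_Mapping.single x k) = (if x \<in> A then k else 0)"
  by (simp add: weight_def lookup_single when_def)

lemma weight_colour_classes:
  assumes "finite V"
  shows "weight V m = (\<Sum>t\<in>c ` V. weight {z\<in>V. c z = t} m)"
  unfolding weight_def using assms by (rule sum.image_gen)

lemma weight_posE:
  assumes "weight A m > 0"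
  obtains x where "x \<in> A" "Poly_Mapping.lookup m x > 0"
  using assms unfolding weight_def by (metis gr0I sum.neutral less_irrefl)

lemma split_single:
  fixes m :: "'v \<Rightarrow>\<^sub>0 nat"
  assumes "Poly_Mapping.lookup m x > 0"
  obtains m' where "m = m' + Poly_Mapping.single x 1"
proof
  show "m = (m - Poly_Mapping.single x 1) + Poly_Mapping.single x 1"
    using assms by (intro poly_mapping_eqI) (auto simp: lookup_add lookup_minus lookup_single when_def)
qed

lemma keys_add_nat:
  "Poly_Mapping.keys (m + m' :: 'v \<Rightarrow>\<^sub>0 nat) = Poly_Mapping.keys m \<union> Poly_Mapping.keys m'"
  by (auto simp: in_keys_iff lookup_add)

lemma weight_eq_0_iff:
  assumes "finite V" "Poly_Mapping.keys m \<subseteq> V"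
  shows "weight V m = 0 \<longleftrightarrow> m = 0"
proof
  assume "weight V m = 0"
  then show "m = 0"
    using assms by (intro poly_mapping_eqI) (auto simp: weight_def in_keys_iff subset_iff)
qed simp

text \<open>
  Minimality is the absence of proper divisibility between generators.
  Among monomials of one degree, divisibility is equality, so no proper subset generates.
\<close>

lemma min_mon_gens_equal_degree:
  fixes d :: nat
  assumes V: "finite V" and E: "\<And>m. m \<in> E \<Longrightarrow> Poly_Mapping.keys m \<subseteq> V \<and> weight V m = d"
  shows "min_mon_gens V (genideal (mpol_ring V) (monom ` E)) =
    (monom ` E :: ('v, 'k::comm_ring_1) mpol set)"
proof -
  let ?G = "monom ` E :: ('v, 'k) mpol set"
  have G: "?G \<subseteq> monomials V" using E by (auto simp: monomials_def)
  have "genideal (mpol_ring V) H \<noteq> genideal (mpol_ring V) ?G" if H: "H \<subset> ?G" for H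
  proof
    assume eq: "genideal (mpol_ring V) H = genideal (mpol_ring V) ?G"
    obtain m where m: "m \<in> E" "monom m \<notin> H" using H by blast
    have HV: "H \<subseteq> monomials V" using H G by blast
    have "(monom m :: ('v, 'k) mpol) \<in> genideal (mpol_ring V) ?G"
      unfolding monom_in_genideal_iff[OF G] using m(1) E[OF m(1)]
      by (metis add.right_neutral imageI)
    then obtain g e where g: "(monom g :: ('v, 'k) mpol) \<in> H" "m = g + e"
      unfolding eq[symmetric] monom_in_genideal_iff[OF HV] by blast
    have gE: "g \<in> E" using g(1) H by auto
    have "weight V e = 0"
      using E[OF m(1)] E[OF gE] weight_add[of V g e] g(2) by simp
    moreover have "Poly_Mapping.keys e \<subseteq> V" using E[OF m(1)] g(2) by (simp add: keys_add_nat)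
    ultimately have "e = 0" using weight_eq_0_iff[OF V] by blast
    then show False using g m(2) by simp
  qed
  then have "is_min_mon_gens V (genideal (mpol_ring V) ?G) ?G"
    unfolding is_min_mon_gens_def using G by blast
  then show ?thesis
    unfolding min_mon_gens_def using ex1_min_mon_gens[OF G refl] by (rule the1_equality[rotated])
qed

section \<open>Edge ideals of complete multipartite graphs\<close>

definition multipartite_graph :: "'v set \<Rightarrow> ('v \<Rightarrow> 'c) \<Rightarrow> 'v sgraph" where
  "multipartite_graph V c = (V, {{x, y} | x y. x \<in> V \<and> y \<in> V \<and> c x \<noteq> c y})"

definition edge_exps :: "'v set \<Rightarrow> ('v \<Rightarrow> 'c) \<Rightarrow> ('v \<Rightarrow>\<^sub>0 nat) set" where
  "edge_exps V c =
     {Poly_Mapping.single x 1 + Poly_Mapping.single y 1 | x y. x \<in> V \<and> y \<in> V \<and> c x \<noteq> c y}"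

definition balanced :: "'v set \<Rightarrow> ('v \<Rightarrow> 'c) \<Rightarrow> nat \<Rightarrow> ('v \<Rightarrow>\<^sub>0 nat) set" where
  "balanced V c n =
     {m. Poly_Mapping.keys m \<subseteq> V \<and> weight V m = 2 * n \<and> (\<forall>t. weight {z\<in>V. c z = t} m \<le> n)}"

lemma balanced_0:
  assumes "finite V"
  shows "balanced V c 0 = {0}"
  using weight_eq_0_iff[OF assms] by (auto simp: balanced_def)

text \<open>
  The endpoints of an edge have different colours, so each colour gains at most one.
\<close>

lemma balanced_add_edge:
  assumes V: "finite V" and m: "m \<in> balanced V c n" and e: "e \<in> edge_exps V c"
  shows "m + e \<in> balanced V c (Suc n)"
proof -
  obtain x y where xy: "e = Poly_Mapping.single x 1 + Poly_Mapping.single y 1"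
    "x \<in> V" "y \<in> V" "c x \<noteq> c y"
    using e unfolding edge_exps_def by blast
  have fin: "finite {z\<in>V. c z = t}" for t using V by simp
  have "weight {z\<in>V. c z = t} e \<le> 1" for t
    using xy by (auto simp: weight_add weight_single fin)
  then have "weight {z\<in>V. c z = t} (m + e) \<le> Suc n" for t
    using m add_mono[of "weight {z\<in>V. c z = t} m" n "weight {z\<in>V. c z = t} e" 1]
    by (simp add: balanced_def weight_add)
  moreover have "weight V e = 2"
    using xy by (simp add: weight_add weight_single V)
  moreover have "Poly_Mapping.keys e \<subseteq> V"
    using xy by (simp add: keys_add_nat)
  ultimately show ?thesis
    using m by (simp add: balanced_def weight_add keys_add_nat)
qed

text \<open>
  The edge to remove joins a most frequent colour \<open>s\<close> to a most frequent colour \<open>t\<close> among the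
  others. The bound on \<open>s\<close> leaves weight at least \<open>n + 1\<close> for the other colours, so \<open>t\<close> occurs;
  and a third colour of weight \<open>n + 1\<close> would force total weight at least \<open>3(n + 1)\<close>.
\<close>

lemma balanced_Suc_split:
  assumes V: "finite V" and m: "m \<in> balanced V c (Suc n)"
  shows "\<exists>m'\<in>balanced V c n. \<exists>e\<in>edge_exps V c. m = m' + e"
proof -
  define W where "W t = weight {z\<in>V. c z = t} m" for t
  have fin: "finite {z\<in>V. c z = t}" for t using V by simp
  have deg: "weight V m = 2 * Suc n" and keys: "Poly_Mapping.keys m \<subseteq> V"
    and W_le: "W t \<le> Suc n" for t
    using m by (auto simp: balanced_def W_def)
  have fC: "finite (c ` V)" using V by simp
  have max: "\<exists>q\<in>A. \<forall>r\<in>A. W r \<le> W q" if A: "finite A" "A \<noteq> {}" for A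
  proof -
    have "Max (W ` A) \<in> W ` A" using A by simp
    then obtain q where "q \<in> A" "Max (W ` A) = W q" by blast
    then show ?thesis using A Max_ge[of "W ` A"] by (intro bexI[of _ q]) auto
  qed
  have tot: "(\<Sum>t\<in>c ` V. W t) = 2 * Suc n"
    using weight_colour_classes[OF V, of m c] deg by (simp add: W_def)
  then have "c ` V \<noteq> {}" by auto
  from max[OF fC this] obtain s
    where s: "s \<in> c ` V" "\<And>r. r \<in> c ` V \<Longrightarrow> W r \<le> W s"
    by blast
  have tot': "(\<Sum>t\<in>c ` V - {s}. W t) \<ge> Suc n"
    using tot W_le[of s] sum.remove[OF fC s(1), of W] by simp
  have "c ` V - {s} \<noteq> {}"
  proof
    assume "c ` V - {s} = {}"
    with tot' show False by (simp only: sum.empty)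
  qed
  moreover have "finite (c ` V - {s})" using fC by simp
  ultimately obtain t
    where t: "t \<in> c ` V - {s}" "\<And>r. r \<in> c ` V - {s} \<Longrightarrow> W r \<le> W t"
    using max[of "c ` V - {s}"] by blast
  have Wt: "W t > 0"
  proof (rule ccontr)
    assume "\<not> W t > 0"
    then have "(\<Sum>t\<in>c ` V - {s}. W t) = 0" using t(2) by (intro sum.neutral) fastforce
    then show False using tot' by simp
  qed
  have Ws: "W s > 0" using Wt s(2)[of t] t(1) by auto
  \<comment> \<open>A third colour of weight \<open>n + 1\<close> would give \<open>s\<close> and \<open>t\<close> at least that weight too.\<close>
  have third: "W r \<le> n" if "r \<noteq> s" "r \<noteq> t" for r
  proof (cases "r \<in> c ` V")
    case True
    have "W s + W t + W r = (\<Sum>q\<in>{s, t, r}. W q)" using that t(1) by auto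
    also have "\<dots> \<le> (\<Sum>q\<in>c ` V. W q)"
      using True s(1) t(1) fC by (intro sum_mono2) auto
    finally show ?thesis
      using tot s(2)[of r] t(2)[of r] True that by simp
  next
    case False
    then have "{z\<in>V. c z = r} = {}" by auto
    then show ?thesis by (simp only: W_def weight_def sum.empty zero_le)
  qed
  obtain x where x: "x \<in> V" "c x = s" "Poly_Mapping.lookup m x > 0"
    using Ws unfolding W_def by (elim weight_posE) auto
  obtain y where y: "y \<in> V" "c y = t" "Poly_Mapping.lookup m y > 0"
    using Wt unfolding W_def by (elim weight_posE) auto
  have c_xy: "c x \<noteq> c y" using x y t(1) by auto
  then have xy: "x \<noteq> y" by blast
  obtain m1 where m1: "m = m1 + Poly_Mapping.single x 1"
    using x(3) by (rule split_single)
  have "Poly_Mapping.lookup m1 y > 0"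
    using y(3) xy by (simp add: m1 lookup_add lookup_single)
  then obtain m' where m': "m1 = m' + Poly_Mapping.single y 1"
    by (rule split_single)
  define e :: "'a \<Rightarrow>\<^sub>0 nat" where "e = Poly_Mapping.single x 1 + Poly_Mapping.single y 1"
  have me: "m = m' + e" by (simp add: e_def m1 m' ac_simps)
  have "e \<in> edge_exps V c" unfolding e_def edge_exps_def using x(1) y(1) c_xy by blast
  moreover have "m' \<in> balanced V c n"
  proof -
    have "weight V e = 2"
      using x y xy by (simp add: e_def weight_add weight_single V)
    then have "weight V m' = 2 * n" using deg by (simp add: me weight_add)
    moreover have "Poly_Mapping.keys m' \<subseteq> V" using keys by (simp add: me keys_add_nat)
    moreover have "weight {z\<in>V. c z = r} m' \<le> n" for r
    proof -
      have "W r = weight {z\<in>V. c z = r} m' + weight {z\<in>V. c z = r} e"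
        by (simp add: W_def me weight_add)
      moreover have "weight {z\<in>V. c z = r} e = (if r = s \<or> r = t then 1 else 0)"
        using x y t(1) by (auto simp: e_def weight_add weight_single fin)
      ultimately show ?thesis using third[of r] W_le[of r] by (auto split: if_splits)
    qed
    ultimately show ?thesis by (simp add: balanced_def)
  qed
  ultimately show ?thesis using me by blast
qed

lemma edge_ideal_multipartite:
  "(edge_ideal (multipartite_graph V c) :: ('v, 'k::comm_ring_1) mpol set) =
     genideal (mpol_ring V) (monom ` edge_exps V c)"
proof -
  have "{x, y} \<in> snd (multipartite_graph V c) \<longleftrightarrow> x \<in> V \<and> y \<in> V \<and> c x \<noteq> c y" for x y
    by (auto simp: multipartite_graph_def doubleton_eq_iff)
  then have "{Var x * Var y | x y. {x, y} \<in> snd (multipartite_graph V c)} =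
    (monom ` edge_exps V c :: ('v, 'k) mpol set)"
    unfolding edge_exps_def Var_def monom_mult by blast
  then show ?thesis by (simp add: edge_ideal_def multipartite_graph_def)
qed

text \<open>
  Multiplying generators by edges turns the balanced monomials for \<open>n\<close> into exactly those for
  \<open>n + 1\<close>: \<open>balanced_add_edge\<close> and \<open>balanced_Suc_split\<close> are the two inclusions. The empty product
  starts the induction, as the zeroth power is the unit ideal.
\<close>

lemma edge_ideal_power_multipartite:
  assumes V: "finite V"
  shows "(edge_ideal (multipartite_graph V c) :: ('v, 'k::comm_ring_1) mpol set)
           [^]\<^bsub>ideals_set (mpol_ring V)\<^esub> n =
         genideal (mpol_ring V) (monom ` balanced V c n)"
proof (induction n)
  case 0
  interpret cring "mpol_ring V :: ('v, 'k) mpol ring" by (rule cring_mpol_ring)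
  have "(monom 0 :: ('v, 'k) mpol) = 1" by (simp add: monom_def)
  then show ?case
    using genideal_one by (simp add: balanced_0[OF V] ideals_set_def)
next
  case (Suc n)
  interpret cring "mpol_ring V :: ('v, 'k) mpol ring" by (rule cring_mpol_ring)
  have sub: "(monom ` balanced V c n :: ('v, 'k) mpol set) \<subseteq> carrier (mpol_ring V)"
    "(monom ` edge_exps V c :: ('v, 'k) mpol set) \<subseteq> carrier (mpol_ring V)"
    by (auto simp: balanced_def edge_exps_def keys_add_nat)
  have "{p * q | p q. p \<in> monom ` balanced V c n \<and> q \<in> monom ` edge_exps V c} =
      (monom ` balanced V c (Suc n) :: ('v, 'k) mpol set)"
  proof (intro equalityI subsetI)
    fix r :: "('v, 'k) mpol"
    assume "r \<in> {p * q | p q. p \<in> monom ` balanced V c n \<and> q \<in> monom ` edge_exps V c}"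
    then show "r \<in> monom ` balanced V c (Suc n)"
      by (auto simp: monom_mult intro!: imageI balanced_add_edge[OF V])
  next
    fix r :: "('v, 'k) mpol"
    assume "r \<in> monom ` balanced V c (Suc n)"
    then obtain m' e where "m' \<in> balanced V c n" "e \<in> edge_exps V c" "r = monom (m' + e)"
      using balanced_Suc_split[OF V] by blast
    then show "r \<in> {p * q | p q. p \<in> monom ` balanced V c n \<and> q \<in> monom ` edge_exps V c}"
      unfolding monom_mult[symmetric] by blast
  qed
  then show ?case
    using Suc.IH ideal_prod_genideal[OF sub]
    by (simp add: nat_pow_def edge_ideal_multipartite ideals_set_def)
qed

section \<open>The prime ideal graph\<close>

text \<open>
  The value \<open>None\<close> is the single colour shared by all elements outside \<open>P\<close>, which are pairwise
  non-adjacent.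
\<close>

definition prime_colour :: "'r set \<Rightarrow> 'r \<Rightarrow> 'r option" where
  "prime_colour P z = (if z \<in> P then Some z else None)"

text \<open>
  As \<open>P\<close> is an ideal, a product with a factor in \<open>P\<close> lies in \<open>P\<close>, so an element of \<open>P\<close> is
  joined to everything else; as \<open>P\<close> is prime, two elements outside \<open>P\<close> are never joined.
\<close>

lemma prime_ideal_graph_multipartite:
  assumes "primeideal P R"
  shows "prime_ideal_graph R P = multipartite_graph (carrier R - {\<zero>\<^bsub>R\<^esub>}) (prime_colour P)"
proof -
  interpret primeideal P R by (rule assms)
  have "x \<noteq> y \<and> x \<otimes>\<^bsub>R\<^esub> y \<in> P \<longleftrightarrow> prime_colour P x \<noteq> prime_colour P y"
    if "x \<in> carrier R" "y \<in> carrier R" for x y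
    using that I_prime[OF that] I_l_closed[of y x] I_r_closed[of x y]
    by (auto simp: prime_colour_def)
  then show ?thesis
    unfolding prime_ideal_graph_def multipartite_graph_def by auto
qed

lemma weight_bij_betw:
  assumes "bij_betw w J A"
  shows "weight A m = (\<Sum>j\<in>J. Poly_Mapping.lookup m (w j))"
  unfolding weight_def using sum.reindex_bij_betw[OF assms] by metis

text \<open>
  Colour classes are singletons on the part \<open>U\<close> inside \<open>P\<close>, where balance bounds each exponent
  separately, while \<open>V'\<close> is one class, where it bounds the sum of the exponents. The index sets
  \<open>J\<close> and \<open>L\<close> number the variables, so that the conditions can be read off exponent families.
\<close>

lemma balanced_prime_colour_iff:
  assumes V: "finite V" "V = U \<union> V'" "U \<inter> V' = {}"
    and P: "U \<subseteq> P" "V' \<inter> P = {}"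
    and u: "bij_betw u J U" and v: "bij_betw v L V'"
  shows "m \<in> balanced V (prime_colour P) n \<longleftrightarrow> Poly_Mapping.keys m \<subseteq> V \<and>
     (\<Sum>i\<in>J. Poly_Mapping.lookup m (u i)) + (\<Sum>l\<in>L. Poly_Mapping.lookup m (v l)) = 2 * n \<and>
     (\<Sum>l\<in>L. Poly_Mapping.lookup m (v l)) \<le> n \<and> (\<forall>i\<in>J. Poly_Mapping.lookup m (u i) \<le> n)"
proof -
  have "weight V m = weight U m + weight V' m"
    using V by (simp add: weight_def sum.union_disjoint)
  moreover have "{z\<in>V. prime_colour P z = None} = V'"
    using V P by (auto simp: prime_colour_def)
  moreover have "{z\<in>V. prime_colour P z = Some t} = (if t \<in> U then {t} else {})" for t
    using V P by (auto simp: prime_colour_def)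
  then have "(\<forall>t. weight {z\<in>V. prime_colour P z = Some t} m \<le> n) \<longleftrightarrow>
      (\<forall>t\<in>U. Poly_Mapping.lookup m t \<le> n)"
    by (auto simp: weight_def)
  moreover have "U = u ` J" using u by (simp add: bij_betw_def)
  ultimately show ?thesis
    unfolding balanced_def split_option_all
    using weight_bij_betw[OF u, of m] weight_bij_betw[OF v, of m] by auto
qed

lemma prod_Var_powers:
  "(\<Prod>j\<in>J. (Var (w j) :: ('v, 'k::comm_ring_1) mpol) ^ f j) =
     monom (\<Sum>j\<in>J. Poly_Mapping.single (w j) (f j))"
proof -
  have pow: "(Var x :: ('v, 'k) mpol) ^ k = monom (Poly_Mapping.single x k)" for x k
  proof (induction k)
    case 0
    show ?case by (simp add: monom_def)
  next
    case (Suc k)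
    then show ?case by (simp add: Var_def monom_mult single_add[symmetric])
  qed
  show ?thesis
  proof (induction J rule: infinite_finite_induct)
    case (insert j J)
    then show ?case by (simp add: pow monom_mult)
  qed (simp_all add: monom_def)
qed

lemma lookup_sum_single:
  assumes "finite J" "inj_on w J"
  shows "i \<in> J \<Longrightarrow>
      Poly_Mapping.lookup (\<Sum>j\<in>J. Poly_Mapping.single (w j) (f j :: nat)) (w i) = f i"
    and "z \<notin> w ` J \<Longrightarrow>
      Poly_Mapping.lookup (\<Sum>j\<in>J. Poly_Mapping.single (w j) (f j :: nat)) z = 0"
proof -
  assume "i \<in> J"
  then have "(f j when w j = w i) = (if j = i then f j else 0)" if "j \<in> J" for j
    using assms(2) that by (auto simp: inj_on_eq_iff)
  then show "Poly_Mapping.lookup (\<Sum>j\<in>J. Poly_Mapping.single (w j) (f j)) (w i) = f i"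
    using assms(1) \<open>i \<in> J\<close> by (simp add: lookup_sum lookup_single)
next
  assume "z \<notin> w ` J"
  then show "Poly_Mapping.lookup (\<Sum>j\<in>J. Poly_Mapping.single (w j) (f j)) z = 0"
    by (auto simp: lookup_sum lookup_single when_def intro!: sum.neutral)
qed

theorem theorem4p3:
  fixes R :: "('r, 'm) ring_scheme" and P :: "'r set"
    and a b n :: nat and u v :: "nat \<Rightarrow> 'r"
    and x y :: "nat \<Rightarrow> ('r, 'k::field) mpol"
    and S :: "('r, 'k) mpol ring" and I :: "('r, 'k) mpol set"
  assumes "cring R" and "finite (carrier R)"
    and "primeideal P R" and "card P \<ge> 2"
    and "a = card P - 1" and "b = card P * (card (carrier (R Quot P)) - 1)"
    and "bij_betw u {1..a} (P - {\<zero>\<^bsub>R\<^esub>})" and "bij_betw v {1..b} (carrier R - P)"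
    and "x = (\<lambda>i. Var (u i))" and "y = (\<lambda>l. Var (v l))"
    and "S = mpol_ring (carrier R - {\<zero>\<^bsub>R\<^esub>})"
    and "I = edge_ideal (prime_ideal_graph R P)"
    and "n \<ge> 1"
  shows "min_mon_gens (carrier R - {\<zero>\<^bsub>R\<^esub>}) (I [^]\<^bsub>ideals_set S\<^esub> n) =
    {(\<Prod>i=1..a. x i ^ \<alpha> i) * (\<Prod>l=1..b. y l ^ \<beta> l) | \<alpha> \<beta>.
       (\<Sum>i=1..a. \<alpha> i) + (\<Sum>l=1..b. \<beta> l) = 2 * n \<and> (\<Sum>l=1..b. \<beta> l) \<le> n \<and>
       (\<forall>i\<in>{1..a}. 0 \<le> \<alpha> i \<and> \<alpha> i \<le> n)}"
proof -
  define V where "V = carrier R - {\<zero>\<^bsub>R\<^esub>}"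
  define U where "U = P - {\<zero>\<^bsub>R\<^esub>}"
  define V' where "V' = carrier R - P"
  interpret primeideal P R by (rule assms(3))
  have V: "finite V" "V = U \<union> V'" "U \<inter> V' = {}" and P: "U \<subseteq> P" "V' \<inter> P = {}"
    using assms(2) a_subset by (auto simp: V_def U_def V'_def)
  have u: "bij_betw u {1..a} U" and v: "bij_betw v {1..b} V'"
    using assms(7,8) by (simp_all add: U_def V'_def)
  have uU: "inj_on u {1..a}" "u ` {1..a} = U" and vV: "inj_on v {1..b}" "v ` {1..b} = V'"
    using u v by (auto simp: bij_betw_def)
  \<comment> \<open>The exponent vector of \<open>x\<^sup>\<alpha> y\<^sup>\<beta>\<close>.\<close>
  define ex :: "(nat \<Rightarrow> nat) \<Rightarrow> (nat \<Rightarrow> nat) \<Rightarrow> 'r \<Rightarrow>\<^sub>0 nat" where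
    "ex \<alpha> \<beta> = (\<Sum>i=1..a. Poly_Mapping.single (u i) (\<alpha> i)) +
             (\<Sum>l=1..b. Poly_Mapping.single (v l) (\<beta> l))" for \<alpha> \<beta>
  have prod_ex: "(\<Prod>i=1..a. x i ^ \<alpha> i) * (\<Prod>l=1..b. y l ^ \<beta> l) = monom (ex \<alpha> \<beta>)" for \<alpha> \<beta>
    by (simp add: assms(9,10) prod_Var_powers monom_mult ex_def)
  have ex_u: "Poly_Mapping.lookup (ex \<alpha> \<beta>) (u i) = \<alpha> i" if "i \<in> {1..a}" for i \<alpha> \<beta>
  proof -
    have "u i \<notin> v ` {1..b}" using V(3) uU(2) vV(2) that by blast
    then show ?thesis
      using lookup_sum_single(1)[OF _ uU(1) that, of \<alpha>]
        lookup_sum_single(2)[OF _ vV(1), of "u i" \<beta>]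
      by (simp only: ex_def lookup_add finite_atLeastAtMost) simp
  qed
  have ex_v: "Poly_Mapping.lookup (ex \<alpha> \<beta>) (v l) = \<beta> l" if "l \<in> {1..b}" for l \<alpha> \<beta>
  proof -
    have "v l \<notin> u ` {1..a}" using V(3) uU(2) vV(2) that by blast
    then show ?thesis
      using lookup_sum_single(1)[OF _ vV(1) that, of \<beta>]
        lookup_sum_single(2)[OF _ uU(1), of "v l" \<alpha>]
      by (simp only: ex_def lookup_add finite_atLeastAtMost) simp
  qed
  have ex_out: "Poly_Mapping.lookup (ex \<alpha> \<beta>) z = 0" if "z \<notin> V" for z \<alpha> \<beta>
    using that V(2) uU(2) vV(2) lookup_sum_single(2)[OF _ uU(1), of z \<alpha>]
      lookup_sum_single(2)[OF _ vV(1), of z \<beta>]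
    by (simp only: ex_def lookup_add finite_atLeastAtMost) simp
  have ex_keys: "Poly_Mapping.keys (ex \<alpha> \<beta>) \<subseteq> V" for \<alpha> \<beta>
    using ex_out by (auto simp: in_keys_iff)
  have ex_surj: "m = ex (\<lambda>i. Poly_Mapping.lookup m (u i)) (\<lambda>l. Poly_Mapping.lookup m (v l))"
    if "Poly_Mapping.keys m \<subseteq> V" for m
  proof (rule poly_mapping_eqI)
    fix z
    consider "z \<in> u ` {1..a}" | "z \<in> v ` {1..b}" | "z \<notin> V" using uU(2) vV(2) V(2) by blast
    then show "Poly_Mapping.lookup m z = Poly_Mapping.lookup
        (ex (\<lambda>i. Poly_Mapping.lookup m (u i)) (\<lambda>l. Poly_Mapping.lookup m (v l))) z"
    proof cases
      case 3
      then have "z \<notin> Poly_Mapping.keys m" using that by blast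
      then show ?thesis by (simp add: ex_out[OF 3] in_keys_iff)
    qed (use ex_u ex_v in auto)
  qed
  have mem: "ex \<alpha> \<beta> \<in> balanced V (prime_colour P) n \<longleftrightarrow>
      (\<Sum>i=1..a. \<alpha> i) + (\<Sum>l=1..b. \<beta> l) = 2 * n \<and> (\<Sum>l=1..b. \<beta> l) \<le> n \<and>
       (\<forall>i\<in>{1..a}. 0 \<le> \<alpha> i \<and> \<alpha> i \<le> n)" for \<alpha> \<beta>
  proof -
    have "(\<Sum>i=1..a. Poly_Mapping.lookup (ex \<alpha> \<beta>) (u i)) = (\<Sum>i=1..a. \<alpha> i)"
      by (rule sum.cong[OF refl ex_u])
    moreover have "(\<Sum>l=1..b. Poly_Mapping.lookup (ex \<alpha> \<beta>) (v l)) = (\<Sum>l=1..b. \<beta> l)"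
      by (rule sum.cong[OF refl ex_v])
    ultimately show ?thesis
      unfolding balanced_prime_colour_iff[OF V P u v] using ex_keys ex_u by simp
  qed
  have gens: "monom ` balanced V (prime_colour P) n =
      {(monom (ex \<alpha> \<beta>) :: ('r, 'k) mpol) | \<alpha> \<beta>. ex \<alpha> \<beta> \<in> balanced V (prime_colour P) n}"
    (is "_ = ?M")
  proof (intro equalityI subsetI)
    fix p :: "('r, 'k) mpol"
    assume "p \<in> monom ` balanced V (prime_colour P) n"
    then obtain m where m: "m \<in> balanced V (prime_colour P) n" "p = monom m" by blast
    then have "Poly_Mapping.keys m \<subseteq> V" by (simp add: balanced_def)
    from ex_surj[OF this] obtain \<alpha> \<beta> where "m = ex \<alpha> \<beta>" by blast
    with m show "p \<in> ?M" by blast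
  qed blast
  have "I [^]\<^bsub>ideals_set S\<^esub> n =
      genideal (mpol_ring V) (monom ` balanced V (prime_colour P) n)"
    using edge_ideal_power_multipartite[OF V(1)]
    by (simp add: assms(11,12) prime_ideal_graph_multipartite[OF assms(3)] flip: V_def)
  then have "min_mon_gens V (I [^]\<^bsub>ideals_set S\<^esub> n) = monom ` balanced V (prime_colour P) n"
    using min_mon_gens_equal_degree[OF V(1), of "balanced V (prime_colour P) n" "2 * n"]
    by (simp add: balanced_def)
  then show ?thesis
    unfolding prod_ex V_def[symmetric] gens mem .
qed

end
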